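(* Let $(X,A,B,p,q,k,s)$ be a semibiproduct of monoids. If $pk=0$ then $p$ is the cokernel of $k$ in the category of monoids.
   Context: A semibiproduct of monoids $(X,A,B,p,q,k,s)$ consists of monoids $X,A,B$ (written additively with neutral element $0$, not necessarily commutative), monoid homomorphisms $k\colon X\to A$ and $p\colon A\to B$, and set-theoretical maps $q\colon A\to X$ and $s\colon B\to A$ (not required to be homomorphisms), such that $kq(a)+sp(a)=a$ for all $a\in A$, $ps=1_B$ and $qk=1_X$. Composition of maps is written by juxtaposition; $0$ also denotes the trivial homomorphism, constantly equal to the neutral element. *)

theory Defs
  imports "HOL-Algebra.Group"
begin

text \<open>Monoids are records with a carrier set, written multiplicatively: \<open>\<otimes>\<close> and \<open>\<one>\<close>
  play the roles of \<open>+\<close> and \<open>0\<close>. Commutativity is not assumed.\<close>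

text \<open>The library's \<^const>\<open>hom\<close> does not require preservation of the neutral element,
  which is not automatic for monoids.\<close>

definition mon_hom :: "('a, 'm) monoid_scheme \<Rightarrow> ('b, 'n) monoid_scheme \<Rightarrow> ('a \<Rightarrow> 'b) set"
  where "mon_hom G H = {h \<in> hom G H. h \<one>\<^bsub>G\<^esub> = \<one>\<^bsub>H\<^esub>}"

locale semibiproduct =
  X: monoid X + A: monoid A + B: monoid B
  for X :: "('x, 'm) monoid_scheme"
    and A :: "('a, 'n) monoid_scheme"
    and B :: "('b, 'l) monoid_scheme" +
  fixes p :: "'a \<Rightarrow> 'b" and q :: "'a \<Rightarrow> 'x" and k :: "'x \<Rightarrow> 'a" and s :: "'b \<Rightarrow> 'a"
  assumes k_hom: "k \<in> mon_hom X A"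
    and p_hom: "p \<in> mon_hom A B"
    and q_map: "q \<in> carrier A \<rightarrow> carrier X"
    and s_map: "s \<in> carrier B \<rightarrow> carrier A"
    and kq_sp: "\<And>a. a \<in> carrier A \<Longrightarrow> k (q a) \<otimes>\<^bsub>A\<^esub> s (p a) = a"
    and p_s: "\<And>b. b \<in> carrier B \<Longrightarrow> p (s b) = b"
    and q_k: "\<And>x. x \<in> carrier X \<Longrightarrow> q (k x) = x"

text \<open>Cokernel of \<open>k\<close> in the category of monoids, i.e. coequaliser of \<open>k\<close> and the trivial
  homomorphism. A formula cannot quantify over types, so the test objects \<open>C\<close> range over all
  monoids whose elements come from the type \<open>'c\<close>; the first argument exposes that type, and a
  theorem with \<open>'c\<close> free holds for every choice of it. As values outside the carrier are
  irrelevant, uniqueness of the induced homomorphism is among the functions in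
  \<^term>\<open>extensional (carrier B)\<close>.\<close>

definition is_cokernel ::
  "'c itself \<Rightarrow> ('x, 'm) monoid_scheme \<Rightarrow> ('a, 'n) monoid_scheme \<Rightarrow> ('b, 'l) monoid_scheme
    \<Rightarrow> ('x \<Rightarrow> 'a) \<Rightarrow> ('a \<Rightarrow> 'b) \<Rightarrow> bool"
  where "is_cokernel _ X A B k p \<longleftrightarrow>
    p \<in> mon_hom A B \<and>
    (\<forall>x\<in>carrier X. p (k x) = \<one>\<^bsub>B\<^esub>) \<and>
    (\<forall>(C :: 'c monoid) f.
      monoid C \<longrightarrow> f \<in> mon_hom A C \<longrightarrow> (\<forall>x\<in>carrier X. f (k x) = \<one>\<^bsub>C\<^esub>) \<longrightarrow>
      (\<exists>!h. h \<in> mon_hom B C \<and> h \<in> extensional (carrier B) \<and>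
        (\<forall>a\<in>carrier A. h (p a) = f a)))"

end

theory Submission
  imports Defs
begin

text \<open>A homomorphism \<open>f\<close> that is trivial on the image of \<open>k\<close> satisfies
  \<open>f a = f (k (q a) \<otimes> s (p a)) = f (s (p a))\<close>, so it depends only on \<open>p a\<close> and
  factors through \<open>p\<close> as \<open>f \<circ> s\<close>. Although \<open>s\<close> is not a homomorphism, \<open>f \<circ> s\<close> is one,
  because \<open>p\<close> maps \<open>s b \<otimes> s b'\<close> and \<open>s (b \<otimes> b')\<close> to the same element.\<close>

lemma mon_homD:
  assumes "h \<in> mon_hom G H"
  shows mon_hom_closed: "x \<in> carrier G \<Longrightarrow> h x \<in> carrier H"
    and mon_hom_mult: "x \<in> carrier G \<Longrightarrow> y \<in> carrier G \<Longrightarrow> h (x \<otimes>\<^bsub>G\<^esub> y) = h x \<otimes>\<^bsub>H\<^esub> h y"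
    and mon_hom_one: "h \<one>\<^bsub>G\<^esub> = \<one>\<^bsub>H\<^esub>"
  using assms by (auto simp: mon_hom_def hom_def)

context semibiproduct
begin

lemma s_closed: "b \<in> carrier B \<Longrightarrow> s b \<in> carrier A"
  using s_map by blast

lemma trivial_on_k_eq:
  assumes "monoid C" and f: "f \<in> mon_hom A C"
    and fk: "\<forall>x\<in>carrier X. f (k x) = \<one>\<^bsub>C\<^esub>" and a: "a \<in> carrier A"
  shows "f (s (p a)) = f a"
proof -
  interpret C: monoid C by fact
  have q: "q a \<in> carrier X"
    using q_map a by blast
  have sp: "s (p a) \<in> carrier A"
    by (intro s_closed mon_hom_closed[OF p_hom] a)
  have "f a = f (k (q a)) \<otimes>\<^bsub>C\<^esub> f (s (p a))"
    using mon_hom_mult[OF f mon_hom_closed[OF k_hom q] sp] kq_sp[OF a] by simp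
  then show ?thesis
    using fk q mon_hom_closed[OF f sp] by simp
qed

lemma trivial_on_k_comp_s_hom:
  assumes C: "monoid C" and f: "f \<in> mon_hom A C"
    and fk: "\<forall>x\<in>carrier X. f (k x) = \<one>\<^bsub>C\<^esub>"
  shows "restrict (f \<circ> s) (carrier B) \<in> mon_hom B C"
proof -
  note fsp = trivial_on_k_eq[OF C f fk]
  \<comment> \<open>\<open>s\<close> itself need not preserve the neutral element. The composite
    does: at the neutral element of \<open>A\<close>, which \<open>p\<close> preserves,
    \<open>fsp\<close> replaces the value of \<open>f \<circ> s\<close> by that of
    \<open>f\<close>.\<close>
  have "f (s \<one>\<^bsub>B\<^esub>) = \<one>\<^bsub>C\<^esub>"
    using fsp[OF A.one_closed] by (simp add: mon_hom_one[OF p_hom] mon_hom_one[OF f])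
  \<comment> \<open>Apply \<open>fsp\<close> to the product of \<open>s b\<close> and
    \<open>s b'\<close>, whose image under \<open>p\<close> is the product of \<open>b\<close> and
    \<open>b'\<close> by \<open>p_s\<close>.\<close>
  moreover have "f (s (b \<otimes>\<^bsub>B\<^esub> b')) = f (s b) \<otimes>\<^bsub>C\<^esub> f (s b')"
    if "b \<in> carrier B" "b' \<in> carrier B" for b b'
    using fsp[of "s b \<otimes>\<^bsub>A\<^esub> s b'"] that
    by (simp add: s_closed p_s mon_hom_mult[OF p_hom] mon_hom_mult[OF f])
  ultimately show ?thesis
    by (auto simp: mon_hom_def[of B] hom_def s_closed mon_hom_closed[OF f])
qed

end

theorem corollary2:
  fixes X :: "('x, 'm) monoid_scheme"
    and A :: "('a, 'n) monoid_scheme"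
    and B :: "('b, 'l) monoid_scheme"
    and p :: "'a \<Rightarrow> 'b" and q :: "'a \<Rightarrow> 'x" and k :: "'x \<Rightarrow> 'a" and s :: "'b \<Rightarrow> 'a"
  assumes "semibiproduct X A B p q k s"
    and "\<forall>x\<in>carrier X. p (k x) = \<one>\<^bsub>B\<^esub>"
  shows "is_cokernel TYPE('c) X A B k p"
proof -
  interpret semibiproduct X A B p q k s by fact
  have "\<exists>!h. h \<in> mon_hom B C \<and> h \<in> extensional (carrier B) \<and> (\<forall>a\<in>carrier A. h (p a) = f a)"
    if C: "monoid C" and f: "f \<in> mon_hom A C" and fk: "\<forall>x\<in>carrier X. f (k x) = \<one>\<^bsub>C\<^esub>"
    for C :: "'c monoid" and f
  proof (rule ex1I)
    \<comment> \<open>The restriction only sets values outside \<open>carrier B\<close> to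
      \<open>undefined\<close>, as membership in \<open>extensional (carrier B)\<close>
      demands.\<close>
    show "restrict (f \<circ> s) (carrier B) \<in> mon_hom B C \<and>
      restrict (f \<circ> s) (carrier B) \<in> extensional (carrier B) \<and>
      (\<forall>a\<in>carrier A. restrict (f \<circ> s) (carrier B) (p a) = f a)"
      using trivial_on_k_comp_s_hom[OF C f fk] trivial_on_k_eq[OF C f fk]
      by (simp add: mon_hom_closed[OF p_hom])
  next
    fix h
    assume h: "h \<in> mon_hom B C \<and> h \<in> extensional (carrier B) \<and> (\<forall>a\<in>carrier A. h (p a) = f a)"
    show "h = restrict (f \<circ> s) (carrier B)"
    proof (rule extensionalityI)
      fix b
      assume b: "b \<in> carrier B"
      then have "h (p (s b)) = f (s b)"
        using h s_closed by blast
      then show "h b = restrict (f \<circ> s) (carrier B) b"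
        using b by (simp add: p_s)
    qed (use h in auto)
  qed
  then show ?thesis
    using assms(2) p_hom unfolding is_cokernel_def by blast
qed

end
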